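(* Let $E$ be a Banach space, let $(x_{0,n},g_n)_{n\ge1}$ be a sequence in $E\times C^0_b(E,E)$ such that each $g_n$ is a complete vector field, and let $x_n\in C^1([0,+\infty),E)$ be the unique solution of $\dot x_n(t)=g_n(x_n(t))$, $t\ge0$, $x_n(0)=x_{0,n}$. Assume that $(x_{0,n},g_n)\to(x_0,g)$ in $E\times C^0_b(E,E)$ as $n\to\infty$ and that the limit vector field $g$ is complete. Then $(x_n)_{n\ge1}$ converges in $C^1([0,+\infty),E)$ to the unique solution $x$ of $$\dot x(t)=g(x(t)),\quad t\ge0,\qquad x(0)=x_0.$$
   Context: $C^0_b(E,E)$ is the space of continuous maps $g:E\to E$ that are bounded on bounded subsets of $E$, with the topology of uniform convergence on bounded sets. $C^1([0,+\infty),E)$ is the space of continuously differentiable functions $[0,+\infty)\to E$ with the topology of uniform convergence of the functions and of their derivatives on bounded time sets. A vector field is a continuous map $g:E\to E$; it is called complete if it is locally Lipschitz continuous and if, for every $x_0\in E$, the Cauchy problem $\dot x(t)=g(x(t))$, $x(0)=x_0$, admits a unique global solution defined for all $t\ge0$. *)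

theory Defs
  imports "HOL-Analysis.Analysis"
begin

definition C0b :: "('a::banach \<Rightarrow> 'a) set" where
  "C0b = {g. continuous_on UNIV g \<and> (\<forall>B. bounded B \<longrightarrow> bounded (g ` B))}"

definition tendsto_C0b :: "('i \<Rightarrow> 'a::banach \<Rightarrow> 'a) \<Rightarrow> ('a \<Rightarrow> 'a) \<Rightarrow> 'i filter \<Rightarrow> bool" where
  "tendsto_C0b G g F \<longleftrightarrow> (\<forall>B. bounded B \<longrightarrow> uniform_limit B G g F)"

(* Functions on [0,\<infinity>) are represented by functions on all of real whose values at
   negative times are irrelevant. Derivatives are taken within [0,\<infinity>), hence one-sided at 0. *)

definition C1_halfline :: "(real \<Rightarrow> 'a::banach) set" where
  "C1_halfline = {x. \<exists>x'. (\<forall>t\<ge>0. (x has_vector_derivative x' t) (at t within {0..})) \<and>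
                          continuous_on {0..} x'}"

definition tendsto_C1 :: "('i \<Rightarrow> real \<Rightarrow> 'a::banach) \<Rightarrow> (real \<Rightarrow> 'a) \<Rightarrow> 'i filter \<Rightarrow> bool" where
  "tendsto_C1 X x F \<longleftrightarrow> (\<forall>T. T \<subseteq> {0..} \<and> bounded T \<longrightarrow>
     uniform_limit T X x F \<and>
     uniform_limit T (\<lambda>i t. vector_derivative (X i) (at t within {0..}))
                     (\<lambda>t. vector_derivative x (at t within {0..})) F)"

definition global_solution :: "('a::banach \<Rightarrow> 'a) \<Rightarrow> 'a \<Rightarrow> (real \<Rightarrow> 'a) \<Rightarrow> bool" where
  "global_solution g x0 x \<longleftrightarrow> x \<in> C1_halfline \<and> x 0 = x0 \<and>
     (\<forall>t\<ge>0. (x has_vector_derivative g (x t)) (at t within {0..}))"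

definition unique_global_solution :: "('a::banach \<Rightarrow> 'a) \<Rightarrow> 'a \<Rightarrow> (real \<Rightarrow> 'a) \<Rightarrow> bool" where
  "unique_global_solution g x0 x \<longleftrightarrow> global_solution g x0 x \<and>
     (\<forall>y. global_solution g x0 y \<longrightarrow> (\<forall>t\<ge>0. y t = x t))"

(* The library's local_lipschitz is formulated for time-dependent fields; for an autonomous
   field the time argument is a dummy. *)

definition complete_vector_field :: "('a::banach \<Rightarrow> 'a) \<Rightarrow> bool" where
  "complete_vector_field g \<longleftrightarrow> continuous_on UNIV g \<and>
     local_lipschitz (UNIV :: real set) UNIV (\<lambda>_. g) \<and>
     (\<forall>x0. \<exists>x. unique_global_solution g x0 x)"

end

theory Submission
  imports Defs
begin

text \<open>
  Since \<open>E\<close> may be infinite-dimensional, the locally Lipschitz field \<open>g\<close> need not be Lipschitz on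
  bounded sets. But for fixed \<open>T\<close> the arc \<open>x ` {0..T}\<close> is compact, and so some single constant \<open>k\<close> is a
  Lipschitz constant for \<open>g\<close> on every ball of radius \<open>1/k\<close> about a point of the arc
  (\<open>local_lipschitz_uniform_near_compact\<close>). The union of these balls is bounded, hence
  \<open>g\<^sub>n \<rightarrow> g\<close> uniformly on it.

  As long as \<open>x\<^sub>n\<close> stays inside that tube, \<open>u = x\<^sub>n - x\<close> satisfies
  \<open>\<parallel>u'\<parallel> \<le> \<delta> + k\<parallel>u\<parallel>\<close> with \<open>\<delta>\<close> small. Such a \<open>u\<close>, if \<open>\<parallel>u(0)\<parallel> < \<delta>\<close>, can never reach the barrier
  \<open>\<delta> exp ((k+1) t)\<close>: up to the first contact its speed is at most that of the barrier, while it
  started strictly below (\<open>exponential_barrier\<close>). Choosing \<open>\<delta>\<close> so small that the barrier remains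
  below the radius of the tube up to time \<open>T\<close> closes the circle: \<open>x\<^sub>n\<close> cannot leave the tube before
  \<open>T\<close>. The same estimate bounds \<open>\<parallel>u'\<parallel>\<close>, which gives convergence of the derivatives.
\<close>

section \<open>Lipschitz constants near compact sets\<close>

text \<open>
  A compact set need not have a compact neighbourhood here, so the Lipschitz constant cannot be
  taken on a compact enlargement of \<open>K\<close>. Instead, the points around which \<open>g\<close> is
  \<open>k\<close>-Lipschitz at scale \<open>1/k\<close> form a family of sets increasing in \<open>k\<close> whose interiors cover
  the whole space; compactness of \<open>K\<close> selects one of them.
\<close>

lemma local_lipschitz_uniform_near_compact:
  fixes g :: "'a::metric_space \<Rightarrow> 'b::metric_space"
  assumes lip: "local_lipschitz (UNIV :: real set) UNIV (\<lambda>_. g)" and K: "compact K"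
  obtains k :: real where "k > 0" "\<And>p. p \<in> K \<Longrightarrow> k-lipschitz_on (ball p (1 / k)) g"
proof -
  define S where "S k = {p. (real (Suc k))-lipschitz_on (ball p (1 / real (Suc k))) g}" for k
  have mono: "S j \<subseteq> S k" if "j \<le> k" for j k
  proof
    fix p assume "p \<in> S j"
    then have "(real (Suc j))-lipschitz_on (ball p (1 / real (Suc j))) g"
      by (simp add: S_def)
    moreover have "ball p (1 / real (Suc k)) \<subseteq> ball p (1 / real (Suc j))"
      using that by (intro subset_ball) (simp add: frac_le)
    ultimately show "p \<in> S k"
      unfolding S_def mem_Collect_eq using that by (elim lipschitz_on_mono) auto
  qed
  have "\<exists>k. p \<in> interior (S k)" for p
  proof -
    obtain u L where u: "u > 0" and L: "L-lipschitz_on (cball p u) g"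
      using local_lipschitzE[OF lip, of 0 p] by (metis Int_UNIV_right UNIV_I centre_in_cball less_imp_le)
    obtain k :: nat where k: "max L (2 / u) \<le> real k"
      using real_arch_simple by blast
    have "ball p (u / 2) \<subseteq> S k"
    proof
      fix q assume q: "q \<in> ball p (u / 2)"
      have "2 / u \<le> real (Suc k)" using k by simp
      then have "1 / real (Suc k) \<le> u / 2"
        using u by (simp add: field_simps)
      then have "ball q (1 / real (Suc k)) \<subseteq> cball p u"
        using q by (force simp: dist_commute intro: order.trans[OF dist_triangle[of _ _ q]])
      with L k show "q \<in> S k"
        unfolding S_def mem_Collect_eq by (elim lipschitz_on_mono) auto
    qed
    then show ?thesis
      using u by (metis centre_in_ball half_gt_zero interior_maximal open_ball subsetD)
  qed
  then have cover: "K \<subseteq> (\<Union>k. interior (S k))" by blast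
  obtain C where C: "finite C" "K \<subseteq> (\<Union>k\<in>C. interior (S k))"
    by (rule compactE_image[OF K _ cover]) auto
  have "p \<in> S (Max (insert 0 C))" if p: "p \<in> K" for p
  proof -
    obtain j where "j \<in> C" "p \<in> interior (S j)" using C p by blast
    then show ?thesis
      using C(1) mono[of j "Max (insert 0 C)"] interior_subset by fastforce
  qed
  then show thesis
    by (intro that[of "real (Suc (Max (insert 0 C)))"]) (auto simp: S_def)
qed

section \<open>A differential inequality\<close>

text \<open>
  A form of the Gronwall inequality in which the differential inequality has to hold only below
  the barrier; this is what makes it applicable to estimates that are valid only in a
  neighbourhood. The spare \<open>1\<close> in the exponent \<open>L + 1\<close> absorbs the additive error \<open>\<delta>\<close>.
\<close>

lemma exponential_barrier:
  fixes u u' :: "real \<Rightarrow> 'a::real_normed_vector"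
  assumes L: "L \<ge> 0"
    and cont: "continuous_on {0..T} u"
    and deriv: "\<And>t. 0 < t \<Longrightarrow> t < T \<Longrightarrow> (u has_vector_derivative u' t) (at t)"
    and init: "norm (u 0) < \<delta>"
    and bound: "\<And>t. 0 < t \<Longrightarrow> t < T \<Longrightarrow> norm (u t) < \<delta> * exp ((L + 1) * t) \<Longrightarrow>
      norm (u' t) \<le> \<delta> + L * norm (u t)"
    and t: "t \<in> {0..T}"
  shows "norm (u t) < \<delta> * exp ((L + 1) * t)"
proof (rule ccontr)
  define \<phi> where "\<phi> s = \<delta> * exp ((L + 1) * s)" for s
  define A where "A = {s \<in> {0..T}. \<phi> s \<le> norm (u s)}"
  have \<delta>: "\<delta> > 0" using init norm_ge_zero[of "u 0"] by linarith
  assume "\<not> norm (u t) < \<delta> * exp ((L + 1) * t)"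
  then have "t \<in> A" using t by (auto simp: A_def \<phi>_def)
  have cont_\<phi>: "continuous_on I \<phi>" for I
    unfolding \<phi>_def by (intro continuous_intros)
  have "closed A"
    unfolding A_def by (intro continuous_on_closed_Collect_le cont_\<phi> continuous_on_norm cont) auto
  moreover have "bounded A"
    unfolding A_def by (rule bounded_subset[of "{0..T}"]) auto
  ultimately have "compact A" by (simp add: compact_eq_bounded_closed)
  \<comment> \<open>the time of first contact with the barrier\<close>
  then obtain s where s: "s \<in> A" "\<And>r. r \<in> A \<Longrightarrow> s \<le> r"
    using compact_attains_inf[of A] \<open>t \<in> A\<close> by blast
  have "s \<noteq> 0" using s(1) init by (auto simp: A_def \<phi>_def)
  then have s0: "0 < s" "s \<le> T" using s(1) by (auto simp: A_def)
  have "norm (u s - u 0) \<le> \<phi> s - \<phi> 0"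
  proof (rule differentiable_bound_general)
    show "continuous_on {0..s} u" using cont s0 by (auto elim: continuous_on_subset)
    show "(u has_vector_derivative u' r) (at r)" if "0 < r" "r < s" for r
      using that s0 by (intro deriv) auto
    show "(\<phi> has_vector_derivative (L + 1) * \<phi> r) (at r)" for r
      unfolding \<phi>_def has_real_derivative_iff_has_vector_derivative[symmetric]
      by (auto intro!: derivative_eq_intros)
    show "norm (u' r) \<le> (L + 1) * \<phi> r" if r: "0 < r" "r < s" for r
    proof -
      have below: "norm (u r) < \<phi> r"
        using s(2)[of r] r s0 by (force simp: A_def)
      then have "norm (u' r) \<le> \<delta> + L * norm (u r)"
        using r s0 by (intro bound) (auto simp: \<phi>_def)
      also have "\<dots> \<le> \<delta> + L * \<phi> r"
        using L below by (intro add_left_mono mult_left_mono) auto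
      also have "\<delta> \<le> \<phi> r"
        using \<delta> L r by (simp add: \<phi>_def)
      finally show ?thesis by (simp add: algebra_simps)
    qed
  qed (use s0 cont_\<phi> in auto)
  moreover have "norm (u s) \<le> norm (u 0) + norm (u s - u 0)"
    using norm_triangle_sub by blast
  ultimately have "norm (u s) < \<phi> s"
    using init by (simp add: \<phi>_def)
  with s(1) show False by (simp add: A_def)
qed

section \<open>Solutions on the half-line\<close>

lemma global_solution_has_vector_derivative:
  "global_solution g x0 x \<Longrightarrow> t \<ge> 0 \<Longrightarrow>
    (x has_vector_derivative g (x t)) (at t within {0..})"
  by (simp add: global_solution_def)

lemma global_solution_continuous_on:
  assumes "global_solution g x0 x"
  shows "continuous_on {0..} x"
  using assms
  by (intro continuous_on_vector_derivative[where f' = "\<lambda>t. g (x t)"])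
    (simp add: global_solution_def)

lemma global_solution_has_vector_derivative_at:
  assumes "global_solution g x0 x" "t > 0"
  shows "(x has_vector_derivative g (x t)) (at t)"
proof -
  have "at t within {0..} = at t"
    using assms(2) by (intro at_within_interior) (simp add: interior_real_atLeast)
  then show ?thesis
    using global_solution_has_vector_derivative[OF assms(1), of t] assms(2) by simp
qed

lemma global_solution_vector_derivative:
  assumes "global_solution g x0 x" "t \<ge> 0"
  shows "vector_derivative x (at t within {0..}) = g (x t)"
proof (rule vector_derivative_within)
  have "t islimpt {t..t+1}"
    by (intro connected_imp_perfect) auto
  then have "t islimpt {0..}"
    using assms(2) by (elim islimpt_subset) auto
  then show "at t within {0..} \<noteq> bot"
    by (simp add: trivial_limit_within)
qed (rule global_solution_has_vector_derivative[OF assms])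

section \<open>Continuous dependence\<close>

text \<open>
  Below the barrier \<open>x\<^sub>n t\<close> lies in the tube around \<open>x\<close>, where splitting
  \<open>g\<^sub>n (x\<^sub>n t) - g (x t)\<close> at \<open>g (x\<^sub>n t)\<close> gives one term controlled by uniform convergence and
  one by the Lipschitz constant of the limit field. The fields \<open>g\<^sub>n\<close> need not have a common
  Lipschitz constant, which is why the intermediate point is \<open>g (x\<^sub>n t)\<close> and not \<open>g\<^sub>n (x t)\<close>.
\<close>

lemma solutions_close_on_interval:
  fixes g :: "'a::banach \<Rightarrow> 'a"
  assumes lip: "local_lipschitz (UNIV :: real set) UNIV (\<lambda>_. g)"
    and sol: "global_solution g x0 x"
    and soln: "\<And>n. n \<ge> 1 \<Longrightarrow> global_solution (gn n) (x0n n) (xn n)"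
    and init: "x0n \<longlonglongrightarrow> x0"
    and conv: "tendsto_C0b gn g sequentially"
    and "e > 0" "T \<ge> 0"
  shows "\<forall>\<^sub>F n in sequentially. \<forall>t\<in>{0..T}.
    norm (xn n t - x t) < e \<and> norm (gn n (xn n t) - g (x t)) < e"
proof -
  have "compact (x ` {0..T})"
    using global_solution_continuous_on[OF sol]
    by (intro compact_continuous_image) (auto elim: continuous_on_subset)
  then obtain k where k: "k > 0"
    and k_lip: "\<And>p. p \<in> x ` {0..T} \<Longrightarrow> k-lipschitz_on (ball p (1 / k)) g"
    using local_lipschitz_uniform_near_compact[OF lip] by blast
  define B where "B = (\<Union>p\<in>x ` {0..T}. ball p (1 / k))"
  have "bounded B"
  proof -
    obtain b where b: "\<And>p. p \<in> x ` {0..T} \<Longrightarrow> norm p \<le> b"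
      using compact_imp_bounded[OF \<open>compact (x ` {0..T})\<close>] by (auto simp: bounded_iff)
    have "norm y \<le> b + 1 / k" if "y \<in> B" for y
    proof -
      obtain p where p: "p \<in> x ` {0..T}" "norm (p - y) < 1 / k"
        using \<open>y \<in> B\<close> by (auto simp: B_def dist_norm)
      then show ?thesis
        using b[OF p(1)] norm_triangle_sub[of y p] by (simp add: norm_minus_commute)
    qed
    then show ?thesis by (auto simp: bounded_iff)
  qed
  \<comment> \<open>\<open>m\<close> bounds the barrier by the radius of the tube; the factor \<open>k + 1\<close> in \<open>\<delta>\<close> serves the
    derivatives, whose difference is at most \<open>\<delta> + k m / (k + 1) \<le> m\<close>.\<close>
  define m where "m = min (1 / k) (e / 2)"
  define \<delta> where "\<delta> = m / ((k + 1) * exp ((k + 1) * T))"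
  have m: "m > 0" "m \<le> 1 / k" "m < e" using k \<open>e > 0\<close> by (auto simp: m_def)
  have \<delta>: "\<delta> > 0" using m k by (simp add: \<delta>_def)
  have barrier: "\<delta> * exp ((k + 1) * t) \<le> m / (k + 1)" if "t \<in> {0..T}" for t
  proof -
    have "\<delta> * exp ((k + 1) * t) \<le> \<delta> * exp ((k + 1) * T)"
      using that \<delta> k by (intro mult_left_mono) auto
    also have "\<dots> = m / (k + 1)" by (simp add: \<delta>_def)
    finally show ?thesis .
  qed
  have m_frac: "m / (k + 1) \<le> m" using m k by (simp add: field_simps)
  have "\<forall>\<^sub>F n in sequentially. \<forall>y\<in>B. dist (gn n y) (g y) < \<delta>"
    using conv \<open>bounded B\<close> \<delta> by (simp add: tendsto_C0b_def uniform_limit_iff)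
  moreover have "\<forall>\<^sub>F n in sequentially. dist (x0n n) x0 < \<delta>"
    using init \<delta> by (rule tendstoD)
  ultimately show ?thesis
    using eventually_ge_at_top[of "1::nat"]
  proof eventually_elim
    fix n :: nat
    assume near_g: "\<forall>y\<in>B. dist (gn n y) (g y) < \<delta>" and near_x0: "dist (x0n n) x0 < \<delta>"
      and "1 \<le> n"
    note sol_n = soln[OF \<open>1 \<le> n\<close>]
    have rate: "norm (gn n (xn n t) - g (x t)) \<le> \<delta> + k * norm (xn n t - x t)"
      if t: "t \<in> {0..T}" and below: "norm (xn n t - x t) < \<delta> * exp ((k + 1) * t)" for t
    proof -
      have close: "xn n t \<in> ball (x t) (1 / k)"
        using below barrier[OF t] m_frac m(2) by (simp add: dist_norm norm_minus_commute)
      then have "dist (gn n (xn n t)) (g (xn n t)) < \<delta>"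
        using near_g t unfolding B_def by blast
      moreover have "dist (g (xn n t)) (g (x t)) \<le> k * dist (xn n t) (x t)"
        using t k close by (intro lipschitz_onD[OF k_lip[of "x t"]]) auto
      ultimately have "dist (gn n (xn n t)) (g (x t)) \<le> \<delta> + k * dist (xn n t) (x t)"
        using dist_triangle[of "gn n (xn n t)" "g (x t)" "g (xn n t)"] by linarith
      then show ?thesis by (simp add: dist_norm)
    qed
    show "\<forall>t\<in>{0..T}. norm (xn n t - x t) < e \<and> norm (gn n (xn n t) - g (x t)) < e"
    proof
      fix t assume t: "t \<in> {0..T}"
      have below: "norm (xn n t - x t) < \<delta> * exp ((k + 1) * t)"
      proof (rule exponential_barrier[of _ T, OF _ _ _ _ _ t])
        show "0 \<le> k" using k by simp
        show "continuous_on {0..T} (\<lambda>t. xn n t - x t)"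
          using global_solution_continuous_on[OF sol] global_solution_continuous_on[OF sol_n]
          by (auto intro!: continuous_on_diff elim: continuous_on_subset)
        show "((\<lambda>t. xn n t - x t) has_vector_derivative gn n (xn n s) - g (x s)) (at s)"
          if "0 < s" for s
          by (intro has_vector_derivative_diff global_solution_has_vector_derivative_at[OF sol that]
              global_solution_has_vector_derivative_at[OF sol_n that])
        show "norm (xn n 0 - x 0) < \<delta>"
          using near_x0 sol sol_n by (simp add: global_solution_def dist_norm)
      qed (auto intro: rate)
      have "norm (gn n (xn n t) - g (x t)) \<le> \<delta> + k * norm (xn n t - x t)"
        by (rule rate[OF t below])
      also have "\<dots> \<le> m / (k + 1) + k * (m / (k + 1))"
      proof (intro add_mono mult_left_mono)
        show "\<delta> \<le> m / (k + 1)"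
          using barrier[of 0] \<open>T \<ge> 0\<close> by simp
      qed (use below barrier[OF t] k in auto)
      also have "\<dots> = (k + 1) * (m / (k + 1))" by (simp only: distrib_right mult_1_left add.commute)
      also have "\<dots> = m" using k by simp
      finally show "norm (xn n t - x t) < e \<and> norm (gn n (xn n t) - g (x t)) < e"
        using below barrier[OF t] m_frac m(3) by linarith
    qed
  qed
qed

theorem proposition2p1:
  fixes x0n :: "nat \<Rightarrow> 'a::banach" and gn :: "nat \<Rightarrow> 'a \<Rightarrow> 'a" and xn :: "nat \<Rightarrow> real \<Rightarrow> 'a"
    and x0 :: 'a and g :: "'a \<Rightarrow> 'a"
  assumes "\<And>n. n \<ge> 1 \<Longrightarrow> gn n \<in> C0b"
    and "\<And>n. n \<ge> 1 \<Longrightarrow> complete_vector_field (gn n)"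
    and "\<And>n. n \<ge> 1 \<Longrightarrow> unique_global_solution (gn n) (x0n n) (xn n)"
    and "g \<in> C0b"
    and "x0n \<longlonglongrightarrow> x0"
    and "tendsto_C0b gn g sequentially"
    and "complete_vector_field g"
  shows "\<exists>x. unique_global_solution g x0 x \<and> tendsto_C1 xn x sequentially"
proof -
  obtain x where x: "unique_global_solution g x0 x"
    using assms(7) by (auto simp: complete_vector_field_def)
  then have sol: "global_solution g x0 x" by (simp add: unique_global_solution_def)
  have soln: "global_solution (gn n) (x0n n) (xn n)" if "n \<ge> 1" for n
    using assms(3)[OF that] by (simp add: unique_global_solution_def)
  have lip: "local_lipschitz (UNIV :: real set) UNIV (\<lambda>_. g)"
    using assms(7) by (simp add: complete_vector_field_def)
  have "tendsto_C1 xn x sequentially"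
    unfolding tendsto_C1_def uniform_limit_iff
  proof (intro allI impI conjI)
    fix S :: "real set" and e :: real
    assume S: "S \<subseteq> {0..} \<and> bounded S" and e: "e > 0"
    obtain T where T: "T > 0" "\<And>t. t \<in> S \<Longrightarrow> norm t \<le> T"
      using S by (auto simp: bounded_pos)
    have ST: "t \<ge> 0" "t \<in> {0..T}" if "t \<in> S" for t
      using T(2)[OF that] S that by auto
    have close: "\<forall>\<^sub>F n in sequentially. \<forall>t\<in>{0..T}.
        norm (xn n t - x t) < e \<and> norm (gn n (xn n t) - g (x t)) < e"
      using T(1) e by (intro solutions_close_on_interval[OF lip sol soln assms(5,6)]) auto
    show "\<forall>\<^sub>F n in sequentially. \<forall>t\<in>S. dist (xn n t) (x t) < e"
      using close by eventually_elim (auto simp: dist_norm dest: ST)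
    show "\<forall>\<^sub>F n in sequentially. \<forall>t\<in>S. dist (vector_derivative (xn n) (at t within {0..}))
        (vector_derivative x (at t within {0..})) < e"
      using close eventually_ge_at_top[of "1::nat"]
    proof eventually_elim
      case (elim n)
      then show ?case
        using global_solution_vector_derivative[OF sol]
          global_solution_vector_derivative[OF soln[of n]] ST
        by (simp add: dist_norm)
    qed
  qed
  with x show ?thesis by blast
qed

end
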